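(* Set $n=\mathrm{Card}(I)$ and $m=\mathrm{Card}(J)$ with $n,m\ge1$, and let $\mathcal G_A^{HJ}$ be the Hamilton–Jacobi germ with flux limiter $A\in[0,A_0]$ defined in the context. Then: (i) The set $\mathcal G_A^{HJ}$ is $L^1$-dissipative if $A\in[0,A_0]$ and $n=m=1$, or if $A=0$ and $n,m\ge1$. (ii) For $A\in(0,A_0]$, the set $\mathcal G_A^{HJ}$ is not $L^1$-dissipative if $n+m\ge3$.
   Context: $I$ and $J$ are two non-empty finite disjoint index sets (incoming and outgoing branches of a junction). For $\alpha\in I\cup J$, let $a_\alpha<c_\alpha$ be real numbers, $Q_\alpha=[a_\alpha,c_\alpha]$, and let $f^\alpha:Q_\alpha\to[0,+\infty)$ be a continuous, non-constant concave function with $f^\alpha(a_\alpha)=0=f^\alpha(c_\alpha)$. Set $\lambda^\alpha_{max}=\max_{Q_\alpha}f^\alpha>0$ and $A_0=\min_{\alpha\in I\cup J}\lambda^\alpha_{max}$. For $q\in Q_\alpha$ set $$f^{\alpha,+}(q)=\sup_{[a_\alpha,q]}f^\alpha,\qquad f^{\alpha,-}(q)=\sup_{[q,c_\alpha]}f^\alpha .$$ Let $\theta_\alpha\in(0,1]$ for all $\alpha\in I\cup J$ with $\sum_{i\in I}\theta_i=1=\sum_{j\in J}\theta_j$. For $A\in[0,A_0]$ the Hamilton–Jacobi germ is the set $\mathcal G_A^{HJ}$ of all $p=(p_\alpha)_{\alpha\in I\cup J}\in\prod_{\alpha\in I\cup J}Q_\alpha$ for which there exists $\lambda\in\mathbb{R}$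 with $$\theta_\alpha^{-1}f^\alpha(p_\alpha)=\lambda=\min\Big\{A,\ \min_{i\in I}\theta_i^{-1}f^{i,+}(p_i),\ \min_{j\in J}\theta_j^{-1}f^{j,-}(p_j)\Big\}\quad\text{for all }\alpha\in I\cup J.$$ The set $\mathcal G_A^{HJ}$ is called $L^1$-dissipative if for all $p',p\in\mathcal G_A^{HJ}$, $$\sum_{i\in I}\operatorname{sign}(p_i'-p_i)\{f^i(p_i')-f^i(p_i)\}\ \ge\ \sum_{j\in J}\operatorname{sign}(p_j'-p_j)\{f^j(p_j')-f^j(p_j)\}.$$ *)

theory Defs
  imports "HOL-Analysis.Analysis"
begin

text \<open>
  Each flux is a total function on the reals, of which only the restriction to
  \<^term>\<open>{a \<alpha>..c \<alpha>}\<close> is used.  For the continuous fluxes considered, the suprema over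
  compact intervals below are attained and finite.
\<close>

definition lambda_max :: "('b \<Rightarrow> real) \<Rightarrow> ('b \<Rightarrow> real) \<Rightarrow> ('b \<Rightarrow> real \<Rightarrow> real) \<Rightarrow> 'b \<Rightarrow> real" where
  "lambda_max a c f \<alpha> = (SUP q\<in>{a \<alpha>..c \<alpha>}. f \<alpha> q)"

definition A_zero :: "'b set \<Rightarrow> 'b set \<Rightarrow> ('b \<Rightarrow> real) \<Rightarrow> ('b \<Rightarrow> real) \<Rightarrow> ('b \<Rightarrow> real \<Rightarrow> real) \<Rightarrow> real" where
  "A_zero I J a c f = (MIN \<alpha>\<in>I \<union> J. lambda_max a c f \<alpha>)"

definition flux_plus :: "('b \<Rightarrow> real) \<Rightarrow> ('b \<Rightarrow> real \<Rightarrow> real) \<Rightarrow> 'b \<Rightarrow> real \<Rightarrow> real" where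
  "flux_plus a f \<alpha> q = (SUP x\<in>{a \<alpha>..q}. f \<alpha> x)"

definition flux_minus :: "('b \<Rightarrow> real) \<Rightarrow> ('b \<Rightarrow> real \<Rightarrow> real) \<Rightarrow> 'b \<Rightarrow> real \<Rightarrow> real" where
  "flux_minus c f \<alpha> q = (SUP x\<in>{q..c \<alpha>}. f \<alpha> x)"

definition HJ_germ ::
  "'b set \<Rightarrow> 'b set \<Rightarrow> ('b \<Rightarrow> real) \<Rightarrow> ('b \<Rightarrow> real) \<Rightarrow> ('b \<Rightarrow> real \<Rightarrow> real) \<Rightarrow> ('b \<Rightarrow> real) \<Rightarrow> real
    \<Rightarrow> ('b \<Rightarrow> real) set" where
  "HJ_germ I J a c f \<theta> A =
    {p \<in> (\<Pi>\<^sub>E \<alpha>\<in>I \<union> J. {a \<alpha>..c \<alpha>}).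
      \<exists>l. \<forall>\<alpha>\<in>I \<union> J. inverse (\<theta> \<alpha>) * f \<alpha> (p \<alpha>) = l \<and>
        l = Min {A,
                 (MIN i\<in>I. inverse (\<theta> i) * flux_plus a f i (p i)),
                 (MIN j\<in>J. inverse (\<theta> j) * flux_minus c f j (p j))}}"

definition L1_dissipative ::
  "'b set \<Rightarrow> 'b set \<Rightarrow> ('b \<Rightarrow> real \<Rightarrow> real) \<Rightarrow> ('b \<Rightarrow> real) set \<Rightarrow> bool" where
  "L1_dissipative I J f G \<longleftrightarrow>
    (\<forall>p'\<in>G. \<forall>p\<in>G.
      (\<Sum>i\<in>I. sgn (p' i - p i) * (f i (p' i) - f i (p i)))
        \<ge> (\<Sum>j\<in>J. sgn (p' j - p j) * (f j (p' j) - f j (p j))))"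

end

theory Submission
  imports Defs
begin

text \<open>
  Suppose two germ elements \<open>p', p\<close> have levels \<open>\<lambda>' > \<lambda>\<close>.  For \<open>n = m = 1\<close> dissipativity
  can only fail if \<open>p'\<^sub>i < p\<^sub>i\<close> and \<open>p'\<^sub>j > p\<^sub>j\<close>; but then both \<open>f\<^sup>i\<^sup>,\<^sup>+(p\<^sub>i)\<close> and
  \<open>f\<^sup>j\<^sup>,\<^sup>-(p\<^sub>j)\<close> are at least \<open>\<lambda>'\<close>, as is \<open>A\<close>, contradicting the minimum formula for \<open>\<lambda>\<close>.

  With at least three branches take levels \<open>A\<close> and \<open>A/2\<close>.  Each branch can be given either
  sign of \<open>p'\<^sub>\<alpha> - p\<^sub>\<alpha>\<close>, by moving along the increasing or the decreasing part of the flux.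
  The only constraint is that the minimum at level \<open>A/2\<close> be attained, for which one incoming
  branch of positive sign or one outgoing branch of negative sign is enough.  If \<open>n \<ge> 2\<close>, give one
  incoming and all outgoing branches sign \<open>+1\<close>, the other incoming ones \<open>-1\<close>; if \<open>m \<ge> 2\<close>,
  argue symmetrically.
\<close>

section \<open>Level sets of continuous concave functions on an interval\<close>

lemma concave_on_ge_min:
  fixes g :: "real \<Rightarrow> real"
  assumes "concave_on S g" "x \<in> S" "y \<in> S" "p \<in> closed_segment x y"
  shows "min (g x) (g y) \<le> g p"
proof -
  obtain u where u: "0 \<le> u" "u \<le> 1" and p: "p = (1 - u) *\<^sub>R x + u *\<^sub>R y"
    using assms(4) by (auto simp: in_segment)
  have "min (g x) (g y) = (1 - u) * min (g x) (g y) + u * min (g x) (g y)"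
    by (simp add: algebra_simps)
  also have "\<dots> \<le> (1 - u) * g x + u * g y"
    using u by (intro add_mono mult_left_mono) auto
  also have "\<dots> \<le> g p"
    unfolding p using assms(1-3) u by (intro concave_onD) auto
  finally show ?thesis .
qed

lemma le_cSUP_continuous:
  fixes g :: "real \<Rightarrow> real"
  assumes "continuous_on {a..c} g" "{s..t} \<subseteq> {a..c}" "x \<in> {s..t}"
  shows "g x \<le> (SUP y\<in>{s..t}. g y)"
proof (rule cSUP_upper[OF assms(3)])
  have "compact (g ` {s..t})"
    using assms by (intro compact_continuous_image continuous_on_subset[OF assms(1)]) auto
  then show "bdd_above (g ` {s..t})"
    by (intro bounded_imp_bdd_above compact_imp_bounded)
qed

text \<open>The intermediate value theorem gives crossings \<open>l\<close> and \<open>r\<close> of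
  level \<open>v\<close> on both sides of a point of level \<open>w\<close>. The two supremum
  equations are what later let a branch placed at \<open>l\<close> or \<open>r\<close> attain the
  minimum defining the germ.\<close>

lemma concave_attains_levels:
  fixes g :: "real \<Rightarrow> real"
  assumes cont: "continuous_on {a..c} g" and conc: "concave_on {a..c} g"
    and "a \<le> c" "g a \<le> v" "g c \<le> v" "v < w" "w \<le> (SUP x\<in>{a..c}. g x)"
  obtains p' l r where "p' \<in> {a..c}" "g p' = w"
    and "l \<in> {a..c}" "g l = v" "l < p'" "(SUP x\<in>{a..l}. g x) = v"
    and "r \<in> {a..c}" "g r = v" "p' < r" "(SUP x\<in>{r..c}. g x) = v"
proof -
  obtain x where x: "x \<in> {a..c}" "\<And>y. y \<in> {a..c} \<Longrightarrow> g y \<le> g x"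
    using continuous_attains_sup[OF compact_Icc _ cont] \<open>a \<le> c\<close> by auto
  have "(SUP x\<in>{a..c}. g x) \<le> g x"
    using x \<open>a \<le> c\<close> by (intro cSUP_least) auto
  then have "w \<le> g x" using assms by linarith
  moreover have "continuous_on {a..x} g"
    using x by (auto intro: continuous_on_subset[OF cont])
  ultimately obtain p' where p': "a \<le> p'" "p' \<le> x" "g p' = w"
    using IVT'[of g a w x] x assms by auto
  then have p'_in: "p' \<in> {a..c}" using x by auto
  have "continuous_on {a..p'} g" "continuous_on {p'..c} g"
    using p'_in by (auto intro: continuous_on_subset[OF cont])
  then obtain l r where l: "a \<le> l" "l \<le> p'" "g l = v" and r: "p' \<le> r" "r \<le> c" "g r = v"
    using IVT'[of g a v p'] IVT2'[of g c v p'] p'_in p' assms by auto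
  have lt: "l < p'" "p' < r"
    using l r p' \<open>v < w\<close> by (auto simp: order_less_le)
  \<comment> \<open>Since \<open>l\<close> lies between \<open>y\<close> and \<open>p'\<close>,
    concavity gives \<open>min (g y) (g p') \<le> g l = v\<close>; as \<open>g p' = w > v\<close>,
    the minimum must be \<open>g y\<close>.\<close>
  have "g y \<le> v" if "y \<in> {a..l}" for y
    using concave_on_ge_min[OF conc, of y p' l] that l p' p'_in \<open>v < w\<close>
    by (auto simp: closed_segment_eq_real_ivl)
  then have supl: "(SUP y\<in>{a..l}. g y) = v"
    using l by (intro cSup_eq_maximum) auto
  have "g y \<le> v" if "y \<in> {r..c}" for y
    using concave_on_ge_min[OF conc, of p' y r] that r p' p'_in \<open>v < w\<close>
    by (auto simp: closed_segment_eq_real_ivl)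
  then have supr: "(SUP y\<in>{r..c}. g y) = v"
    using r by (intro cSup_eq_maximum) auto
  show ?thesis
    by (rule that[of p' l r]) (use l r p' p'_in lt supl supr in auto)
qed

section \<open>Membership in the germ\<close>

text \<open>Trades the nested minimum for lower bounds plus attainment, which can be used and
  verified branch by branch.\<close>

lemma in_HJ_germ_iff:
  assumes "finite I" "finite J" "I \<noteq> {}" "J \<noteq> {}"
  shows "p \<in> HJ_germ I (J :: 'b set) a c f \<theta> A \<longleftrightarrow>
    p \<in> (\<Pi>\<^sub>E \<alpha>\<in>I \<union> J. {a \<alpha>..c \<alpha>}) \<and>
    (\<exists>l\<le>A. (\<forall>\<alpha>\<in>I \<union> J. inverse (\<theta> \<alpha>) * f \<alpha> (p \<alpha>) = l)
      \<and> (\<forall>i\<in>I. l \<le> inverse (\<theta> i) * flux_plus a f i (p i))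
      \<and> (\<forall>j\<in>J. l \<le> inverse (\<theta> j) * flux_minus c f j (p j))
      \<and> (l = A \<or> (\<exists>i\<in>I. l = inverse (\<theta> i) * flux_plus a f i (p i))
             \<or> (\<exists>j\<in>J. l = inverse (\<theta> j) * flux_minus c f j (p j))))"
proof -
  define P where "P = (\<lambda>i. inverse (\<theta> i) * flux_plus a f i (p i)) ` I"
  define M where "M = (\<lambda>j. inverse (\<theta> j) * flux_minus c f j (p j)) ` J"
  have fin: "finite P" "finite M" "P \<noteq> {}" "M \<noteq> {}"
    using assms by (auto simp: P_def M_def)
  have "Min {A, Min P, Min M} = Min (insert A (P \<union> M))"
    using fin by (simp add: Min_Un)
  then have Min_iff: "l = Min {A, Min P, Min M} \<longleftrightarrow>
    l \<le> A \<and> (\<forall>x\<in>P. l \<le> x) \<and> (\<forall>x\<in>M. l \<le> x) \<and> (l = A \<or> l \<in> P \<or> l \<in> M)" for l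
    using fin by (simp add: eq_Min_iff del: Min_insert) blast
  \<comment> \<open>In \<open>HJ_germ\<close> the condition on \<open>l\<close> stands under the
    quantifier over branches; it can be moved out because \<open>I\<close> is non-empty.\<close>
  have swap: "(\<exists>l. \<forall>\<alpha>\<in>I \<union> J. g \<alpha> = l \<and> R l) \<longleftrightarrow> (\<exists>l. (\<forall>\<alpha>\<in>I \<union> J. g \<alpha> = l) \<and> R l)"
    for g :: "'b \<Rightarrow> real" and R
    using assms(3) by blast
  show ?thesis
    unfolding HJ_germ_def P_def[symmetric] M_def[symmetric] mem_Collect_eq
    by (simp only: Min_iff swap) (auto simp: P_def M_def image_iff)
qed

section \<open>The dissipative cases\<close>

text \<open>A level at most 0 and non-negative fluxes force every flux to vanish on the germ, so
  both sums are 0.\<close>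

lemma L1_dissipative_zero_limiter:
  assumes "finite I" "finite J" "I \<noteq> {}" "J \<noteq> {}"
    and "\<And>\<alpha> q. \<alpha> \<in> I \<union> J \<Longrightarrow> q \<in> {a \<alpha>..c \<alpha>} \<Longrightarrow> 0 \<le> f \<alpha> q"
    and "\<And>\<alpha>. \<alpha> \<in> I \<union> J \<Longrightarrow> 0 < \<theta> \<alpha>"
  shows "L1_dissipative I J f (HJ_germ I J a c f \<theta> 0)"
proof -
  have "f \<alpha> (p \<alpha>) = 0" if p: "p \<in> HJ_germ I J a c f \<theta> 0" and \<alpha>: "\<alpha> \<in> I \<union> J" for p \<alpha>
  proof (rule antisym)
    obtain l where "l \<le> 0" "\<forall>\<alpha>\<in>I \<union> J. inverse (\<theta> \<alpha>) * f \<alpha> (p \<alpha>) = l"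
      using p unfolding in_HJ_germ_iff[OF assms(1-4)] by blast
    then have "inverse (\<theta> \<alpha>) * f \<alpha> (p \<alpha>) \<le> 0"
      using \<alpha> by metis
    then show "f \<alpha> (p \<alpha>) \<le> 0"
      using assms(6)[OF \<alpha>] by (auto simp: mult_le_0_iff)
    show "0 \<le> f \<alpha> (p \<alpha>)"
      using p \<alpha> unfolding in_HJ_germ_iff[OF assms(1-4)] by (auto intro!: assms(5))
  qed
  then show ?thesis
    by (simp add: L1_dissipative_def)
qed

lemma L1_dissipative_one_to_one:
  assumes cont: "continuous_on {a i..c i} (f i)" "continuous_on {a j..c j} (f j)"
    and \<theta>: "\<theta> i = 1" "\<theta> j = 1"
  shows "L1_dissipative {i} {j} f (HJ_germ {i} {j} a c f \<theta> A)"
proof -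
  have key: "p i < p' i \<or> p' j < p j"
    if p': "p' \<in> HJ_germ {i} {j} a c f \<theta> A" and p: "p \<in> HJ_germ {i} {j} a c f \<theta> A"
      and less: "f i (p i) < f i (p' i)" for p' p
  proof (rule ccontr)
    assume "\<not> ?thesis"
    then have le: "p' i \<le> p i" "p j \<le> p' j" by auto
    have "f i (p' i) \<le> flux_plus a f i (p i)"
      unfolding flux_plus_def using p p' le
      by (intro le_cSUP_continuous[OF cont(1)]) (auto simp: in_HJ_germ_iff PiE_iff)
    moreover have "f j (p' j) \<le> flux_minus c f j (p j)"
      unfolding flux_minus_def using p p' le
      by (intro le_cSUP_continuous[OF cont(2)]) (auto simp: in_HJ_germ_iff PiE_iff)
    ultimately show False
      using p p' less by (auto simp: in_HJ_germ_iff \<theta>)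
  qed
  show ?thesis
    unfolding L1_dissipative_def
  proof (intro ballI)
    fix p' p
    assume p': "p' \<in> HJ_germ {i} {j} a c f \<theta> A" and p: "p \<in> HJ_germ {i} {j} a c f \<theta> A"
    have "f i (p i) = f j (p j)" "f i (p' i) = f j (p' j)"
      using p p' by (auto simp: in_HJ_germ_iff \<theta>)
    \<comment> \<open>Both branches share one flux difference. If it is 0, both sides vanish;
      otherwise \<open>key\<close>, applied with the higher element first, makes either the incoming
      side maximal or the outgoing side minimal.\<close>
    then show "(\<Sum>j\<in>{j}. sgn (p' j - p j) * (f j (p' j) - f j (p j)))
        \<le> (\<Sum>i\<in>{i}. sgn (p' i - p i) * (f i (p' i) - f i (p i)))"
      using key[OF p' p] key[OF p p'] by (cases "f j (p j)" "f j (p' j)" rule: linorder_cases) (auto simp: sgn_if)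
  qed
qed

section \<open>Germ elements at levels \<open>A\<close> and \<open>A / 2\<close> with prescribed
  order on each branch\<close>

text \<open>\<open>L\<close> collects the branches on which \<open>p'\<close> is to exceed
  \<open>p\<close>. Each flux drops from \<open>\<theta> \<alpha> * A\<close> to half of that, hence
  the factor \<open>A / 2\<close>.\<close>

lemma HJ_germ_pair_prescribed_signs:
  assumes fin: "finite I" "finite J" "I \<noteq> {}" "J \<noteq> {}"
    and ac: "\<And>\<alpha>. \<alpha> \<in> I \<union> J \<Longrightarrow> a \<alpha> \<le> c \<alpha>"
    and cont: "\<And>\<alpha>. \<alpha> \<in> I \<union> J \<Longrightarrow> continuous_on {a \<alpha>..c \<alpha>} (f \<alpha>)"
    and conc: "\<And>\<alpha>. \<alpha> \<in> I \<union> J \<Longrightarrow> concave_on {a \<alpha>..c \<alpha>} (f \<alpha>)"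
    and zero: "\<And>\<alpha>. \<alpha> \<in> I \<union> J \<Longrightarrow> f \<alpha> (a \<alpha>) = 0 \<and> f \<alpha> (c \<alpha>) = 0"
    and \<theta>: "\<And>\<alpha>. \<alpha> \<in> I \<union> J \<Longrightarrow> 0 < \<theta> \<alpha> \<and> \<theta> \<alpha> \<le> 1"
    and A: "0 < A" "A \<le> A_zero I J a c f"
    and L: "I \<inter> L \<noteq> {} \<or> J - L \<noteq> {}"
  obtains p' p where "p' \<in> HJ_germ I J a c f \<theta> A" "p \<in> HJ_germ I J a c f \<theta> A"
    "\<And>\<alpha>. \<alpha> \<in> I \<union> J \<Longrightarrow>
      sgn (p' \<alpha> - p \<alpha>) * (f \<alpha> (p' \<alpha>) - f \<alpha> (p \<alpha>)) = A / 2 * (if \<alpha> \<in> L then \<theta> \<alpha> else - \<theta> \<alpha>)"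
proof -
  have "\<exists>q' q. q' \<in> {a \<alpha>..c \<alpha>} \<and> q \<in> {a \<alpha>..c \<alpha>} \<and> f \<alpha> q' = \<theta> \<alpha> * A \<and> f \<alpha> q = \<theta> \<alpha> * A / 2 \<and>
      (if \<alpha> \<in> L then q < q' \<and> flux_plus a f \<alpha> q = \<theta> \<alpha> * A / 2
       else q' < q \<and> flux_minus c f \<alpha> q = \<theta> \<alpha> * A / 2)"
    if \<alpha>: "\<alpha> \<in> I \<union> J" for \<alpha>
  proof -
    \<comment> \<open>As weights are at most 1, the bound on \<open>A\<close> keeps the level
      \<open>\<theta> \<alpha> * A\<close> within the range of every flux.\<close>
    have "\<theta> \<alpha> * A \<le> A"
      using \<theta>[OF \<alpha>] A by (simp add: mult_left_le_one_le)
    also have "\<dots> \<le> lambda_max a c f \<alpha>"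
      using A(2) fin \<alpha> unfolding A_zero_def by (auto dest: order_trans[OF _ Min_le])
    finally have "\<theta> \<alpha> * A \<le> (SUP q\<in>{a \<alpha>..c \<alpha>}. f \<alpha> q)"
      by (simp add: lambda_max_def)
    note le_sup = this
    have "0 < \<theta> \<alpha> * A" using \<theta>[OF \<alpha>] A by simp
    then have "f \<alpha> (a \<alpha>) \<le> \<theta> \<alpha> * A / 2" "f \<alpha> (c \<alpha>) \<le> \<theta> \<alpha> * A / 2" "\<theta> \<alpha> * A / 2 < \<theta> \<alpha> * A"
      using zero[OF \<alpha>] by linarith+
    from concave_attains_levels[OF cont[OF \<alpha>] conc[OF \<alpha>] ac[OF \<alpha>] this le_sup]
    obtain q' l r where
      "q' \<in> {a \<alpha>..c \<alpha>}" "f \<alpha> q' = \<theta> \<alpha> * A"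
      "l \<in> {a \<alpha>..c \<alpha>}" "f \<alpha> l = \<theta> \<alpha> * A / 2" "l < q'" "(SUP x\<in>{a \<alpha>..l}. f \<alpha> x) = \<theta> \<alpha> * A / 2"
      "r \<in> {a \<alpha>..c \<alpha>}" "f \<alpha> r = \<theta> \<alpha> * A / 2" "q' < r" "(SUP x\<in>{r..c \<alpha>}. f \<alpha> x) = \<theta> \<alpha> * A / 2" .
    \<comment> \<open>The crossing left of \<open>q'\<close> serves the branches in
      \<open>L\<close>, the one right of \<open>q'\<close> all others.\<close>
    then show ?thesis
      unfolding flux_plus_def flux_minus_def
      by (intro exI[of _ q'] exI[of _ "if \<alpha> \<in> L then l else r"]) auto
  qed
  then obtain P' P where in_Q: "\<And>\<alpha>. \<alpha> \<in> I \<union> J \<Longrightarrow> P' \<alpha> \<in> {a \<alpha>..c \<alpha>} \<and> P \<alpha> \<in> {a \<alpha>..c \<alpha>}"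
    and val: "\<And>\<alpha>. \<alpha> \<in> I \<union> J \<Longrightarrow> f \<alpha> (P' \<alpha>) = \<theta> \<alpha> * A \<and> f \<alpha> (P \<alpha>) = \<theta> \<alpha> * A / 2"
    and side: "\<And>\<alpha>. \<alpha> \<in> I \<union> J \<Longrightarrow>
      (if \<alpha> \<in> L then P \<alpha> < P' \<alpha> \<and> flux_plus a f \<alpha> (P \<alpha>) = \<theta> \<alpha> * A / 2
       else P' \<alpha> < P \<alpha> \<and> flux_minus c f \<alpha> (P \<alpha>) = \<theta> \<alpha> * A / 2)"
    by metis
  \<comment> \<open>The germ consists of extensional functions, so the chosen values are cut off
    outside \<open>I \<union> J\<close>.\<close>
  define p' where "p' = restrict P' (I \<union> J)"
  define p where "p = restrict P (I \<union> J)"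
  have eq: "p' \<alpha> = P' \<alpha>" "p \<alpha> = P \<alpha>" if "\<alpha> \<in> I \<union> J" for \<alpha>
    using that by (auto simp: p'_def p_def)
  have flux_ge: "inverse (\<theta> \<alpha>) * f \<alpha> q \<le> inverse (\<theta> \<alpha>) * flux_plus a f \<alpha> q"
      "inverse (\<theta> \<alpha>) * f \<alpha> q \<le> inverse (\<theta> \<alpha>) * flux_minus c f \<alpha> q"
    if "\<alpha> \<in> I \<union> J" "q \<in> {a \<alpha>..c \<alpha>}" for \<alpha> q
    using that \<theta>[OF that(1)] unfolding flux_plus_def flux_minus_def
    by (auto intro!: mult_left_mono le_cSUP_continuous[OF cont])
  have level: "inverse (\<theta> \<alpha>) * f \<alpha> (P' \<alpha>) = A" "inverse (\<theta> \<alpha>) * f \<alpha> (P \<alpha>) = A / 2"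
    if "\<alpha> \<in> I \<union> J" for \<alpha>
    using val[OF that] \<theta>[OF that] by (auto simp: field_simps)
  \<comment> \<open>At level \<open>A\<close> the limiter itself attains the minimum, so only lower
    bounds remain.\<close>
  have "p' \<in> HJ_germ I J a c f \<theta> A"
    unfolding in_HJ_germ_iff[OF fin]
  proof (intro conjI exI[of _ A] ballI disjI1)
    show "p' \<in> (\<Pi>\<^sub>E \<alpha>\<in>I \<union> J. {a \<alpha>..c \<alpha>})"
      using in_Q unfolding p'_def by (simp only: restrict_PiE_iff) blast
  next
    fix \<alpha> assume "\<alpha> \<in> I" then show "A \<le> inverse (\<theta> \<alpha>) * flux_plus a f \<alpha> (p' \<alpha>)"
      using flux_ge(1)[of \<alpha> "P' \<alpha>"] level[of \<alpha>] in_Q[of \<alpha>] eq[of \<alpha>] by auto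
  next
    fix \<alpha> assume "\<alpha> \<in> J" then show "A \<le> inverse (\<theta> \<alpha>) * flux_minus c f \<alpha> (p' \<alpha>)"
      using flux_ge(2)[of \<alpha> "P' \<alpha>"] level[of \<alpha>] in_Q[of \<alpha>] eq[of \<alpha>] by auto
  qed (use eq level in auto)
  moreover have "p \<in> HJ_germ I J a c f \<theta> A"
    unfolding in_HJ_germ_iff[OF fin]
  proof (intro conjI exI[of _ "A / 2"] ballI)
    show "p \<in> (\<Pi>\<^sub>E \<alpha>\<in>I \<union> J. {a \<alpha>..c \<alpha>})"
      using in_Q unfolding p_def by (simp only: restrict_PiE_iff) blast
  next
    fix \<alpha> assume "\<alpha> \<in> I" then show "A / 2 \<le> inverse (\<theta> \<alpha>) * flux_plus a f \<alpha> (p \<alpha>)"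
      using flux_ge(1)[of \<alpha> "P \<alpha>"] level[of \<alpha>] in_Q[of \<alpha>] eq[of \<alpha>] by auto
  next
    fix \<alpha> assume "\<alpha> \<in> J" then show "A / 2 \<le> inverse (\<theta> \<alpha>) * flux_minus c f \<alpha> (p \<alpha>)"
      using flux_ge(2)[of \<alpha> "P \<alpha>"] level[of \<alpha>] in_Q[of \<alpha>] eq[of \<alpha>] by auto
  next
    \<comment> \<open>Below the limiter some branch must attain the minimum: an incoming one in
      \<open>L\<close> or an outgoing one outside \<open>L\<close>, as provided by the hypothesis on
      \<open>L\<close>.\<close>
    have "A / 2 = inverse (\<theta> i) * flux_plus a f i (p i)" if "i \<in> I \<inter> L" for i
      using that side[of i] \<theta>[of i] eq[of i] by (auto simp: field_simps)
    moreover have "A / 2 = inverse (\<theta> j) * flux_minus c f j (p j)" if "j \<in> J - L" for j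
      using that side[of j] \<theta>[of j] eq[of j] by (auto simp: field_simps)
    ultimately show "A / 2 = A \<or> (\<exists>i\<in>I. A / 2 = inverse (\<theta> i) * flux_plus a f i (p i)) \<or>
        (\<exists>j\<in>J. A / 2 = inverse (\<theta> j) * flux_minus c f j (p j))"
      using L by blast
  qed (use eq level A in auto)
  moreover have "sgn (p' \<alpha> - p \<alpha>) * (f \<alpha> (p' \<alpha>) - f \<alpha> (p \<alpha>)) = A / 2 * (if \<alpha> \<in> L then \<theta> \<alpha> else - \<theta> \<alpha>)"
    if "\<alpha> \<in> I \<union> J" for \<alpha>
    using side[OF that] val[OF that] eq[OF that] by (auto simp: field_simps split: if_splits)
  ultimately show ?thesis using that by blast
qed

section \<open>Sums of signed weights\<close>

text \<open>Evaluates the side of the junction on which one branch has the opposite sign to all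
  others.\<close>

lemma sum_signed_singleton:
  fixes \<theta> :: "'b \<Rightarrow> real"
  assumes "finite S" "k \<in> S" "sum \<theta> S = 1"
  shows "(\<Sum>s\<in>S. if s = k then \<theta> s else - \<theta> s) = 2 * \<theta> k - 1"
proof -
  have "(\<Sum>s\<in>S. if s = k then \<theta> s else - \<theta> s) = (\<Sum>s\<in>S. 2 * (if s = k then \<theta> s else 0) - \<theta> s)"
    by (intro sum.cong) auto
  also have "\<dots> = 2 * \<theta> k - 1"
    using assms by (simp add: sum_subtractf flip: sum_distrib_left)
  finally show ?thesis .
qed

text \<open>A second index takes a positive share of the total 1, leaving less than 1 for
  \<open>k\<close>.\<close>

lemma weight_strictly_between_0_1:
  fixes \<theta> :: "'b \<Rightarrow> real"
  assumes "finite S" "\<And>s. s \<in> S \<Longrightarrow> 0 < \<theta> s" "sum \<theta> S = 1" "card S \<ge> 2"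
  obtains k where "k \<in> S" "0 < \<theta> k" "\<theta> k < 1"
proof -
  obtain k l where kl: "k \<in> S" "l \<in> S" "k \<noteq> l"
    using obtain_subset_with_card_n[OF assms(4)] by (metis card_2_iff insert_subset)
  have "sum \<theta> {k, l} \<le> sum \<theta> S"
    using assms kl by (intro sum_mono2) (auto simp: less_imp_le)
  then have "\<theta> k < 1" using kl assms(2)[of l] assms(3) by auto
  then show ?thesis using that kl assms(2) by blast
qed

section \<open>Dissipativity according to the number of branches\<close>

theorem lemma6p7:
  fixes I J :: "'b set"
    and a c \<theta> :: "'b \<Rightarrow> real"
    and f :: "'b \<Rightarrow> real \<Rightarrow> real"
    and A :: real
    and n m :: nat
  assumes "finite I" "finite J" "I \<noteq> {}" "J \<noteq> {}" "I \<inter> J = {}"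
    and "\<And>\<alpha>. \<alpha> \<in> I \<union> J \<Longrightarrow> a \<alpha> < c \<alpha>"
    and "\<And>\<alpha> q. \<alpha> \<in> I \<union> J \<Longrightarrow> q \<in> {a \<alpha>..c \<alpha>} \<Longrightarrow> 0 \<le> f \<alpha> q"
    and "\<And>\<alpha>. \<alpha> \<in> I \<union> J \<Longrightarrow> continuous_on {a \<alpha>..c \<alpha>} (f \<alpha>)"
    and "\<And>\<alpha>. \<alpha> \<in> I \<union> J \<Longrightarrow> \<not> f \<alpha> constant_on {a \<alpha>..c \<alpha>}"
    and "\<And>\<alpha>. \<alpha> \<in> I \<union> J \<Longrightarrow> concave_on {a \<alpha>..c \<alpha>} (f \<alpha>)"
    and "\<And>\<alpha>. \<alpha> \<in> I \<union> J \<Longrightarrow> f \<alpha> (a \<alpha>) = 0 \<and> f \<alpha> (c \<alpha>) = 0"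
    and "\<And>\<alpha>. \<alpha> \<in> I \<union> J \<Longrightarrow> 0 < \<theta> \<alpha> \<and> \<theta> \<alpha> \<le> 1"
    and "(\<Sum>i\<in>I. \<theta> i) = 1" "(\<Sum>j\<in>J. \<theta> j) = 1"
    and "n = card I" "m = card J" "n \<ge> 1" "m \<ge> 1"
  shows "((A \<in> {0..A_zero I J a c f} \<and> n = 1 \<and> m = 1) \<or> A = 0
            \<longrightarrow> L1_dissipative I J f (HJ_germ I J a c f \<theta> A))
       \<and> (A \<in> {0<..A_zero I J a c f} \<and> n + m \<ge> 3
            \<longrightarrow> \<not> L1_dissipative I J f (HJ_germ I J a c f \<theta> A))"
proof -
  note fin = assms(1-4) and disj = assms(5) and ac = assms(6) and nonneg = assms(7)
    and cont = assms(8) and conc = assms(10) and zero = assms(11) and \<theta> = assms(12)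
    and \<theta>_sum = assms(13,14) and card = assms(15-18)
  have "L1_dissipative I J f (HJ_germ I J a c f \<theta> A)" if one: "n = 1" "m = 1"
  proof -
    obtain i j where "I = {i}" "J = {j}"
      using one card(1,2) by (metis card_1_singletonE)
    \<comment> \<open>On a singleton side the unit sum forces the weight to be 1.\<close>
    then show ?thesis
      using cont \<theta>_sum by (auto intro!: L1_dissipative_one_to_one)
  qed
  moreover have "L1_dissipative I J f (HJ_germ I J a c f \<theta> A)" if "A = 0"
    unfolding that by (rule L1_dissipative_zero_limiter[OF fin]) (use nonneg \<theta> in auto)
  moreover have "\<not> L1_dissipative I J f (HJ_germ I J a c f \<theta> A)"
    if A: "A \<in> {0<..A_zero I J a c f}" and nm: "n + m \<ge> 3"
  proof -
    \<comment> \<open>The common positive factor \<open>A / 2\<close> drops out, so a violation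
      reduces to comparing signed sums of weights.\<close>
    have not_diss: "\<not> L1_dissipative I J f (HJ_germ I J a c f \<theta> A)"
      if L: "I \<inter> L \<noteq> {} \<or> J - L \<noteq> {}"
        and less: "(\<Sum>i\<in>I. if i \<in> L then \<theta> i else - \<theta> i) < (\<Sum>j\<in>J. if j \<in> L then \<theta> j else - \<theta> j)" for L
    proof -
      have A': "0 < A" "A \<le> A_zero I J a c f" using A by auto
      obtain p' p where p: "p' \<in> HJ_germ I J a c f \<theta> A" "p \<in> HJ_germ I J a c f \<theta> A"
        and sgn: "\<And>\<alpha>. \<alpha> \<in> I \<union> J \<Longrightarrow> sgn (p' \<alpha> - p \<alpha>) * (f \<alpha> (p' \<alpha>) - f \<alpha> (p \<alpha>)) =
          A / 2 * (if \<alpha> \<in> L then \<theta> \<alpha> else - \<theta> \<alpha>)"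
        by (rule HJ_germ_pair_prescribed_signs[of I J a c f \<theta> A L, OF fin _ _ _ _ _ _ _ L])
          (assumption | rule A' | erule less_imp_le[OF ac] cont conc zero \<theta> | blast)+
      have "(\<Sum>i\<in>I. sgn (p' i - p i) * (f i (p' i) - f i (p i))) =
          A / 2 * (\<Sum>i\<in>I. if i \<in> L then \<theta> i else - \<theta> i)"
        "(\<Sum>j\<in>J. sgn (p' j - p j) * (f j (p' j) - f j (p j))) =
          A / 2 * (\<Sum>j\<in>J. if j \<in> L then \<theta> j else - \<theta> j)"
        unfolding sum_distrib_left by (intro sum.cong refl sgn UnI1 UnI2; assumption)+
      then have "(\<Sum>i\<in>I. sgn (p' i - p i) * (f i (p' i) - f i (p i)))
          < (\<Sum>j\<in>J. sgn (p' j - p j) * (f j (p' j) - f j (p j)))"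
        using mult_strict_left_mono[OF less, of "A / 2"] \<open>0 < A\<close> by linarith
      then show ?thesis
        using p unfolding L1_dissipative_def by (meson not_le)
    qed
    consider "card I \<ge> 2" | "card J \<ge> 2" using nm card by linarith
    then show ?thesis
    proof cases
      case 1
      then obtain k where k: "k \<in> I" "0 < \<theta> k" "\<theta> k < 1"
        using weight_strictly_between_0_1[of I \<theta>] fin \<theta> \<theta>_sum by blast
      \<comment> \<open>With \<open>L = insert k J\<close> the incoming sum is
        \<open>2 * \<theta> k - 1\<close>, below the outgoing sum 1; \<open>k\<close> witnesses
        \<open>I \<inter> L \<noteq> {}\<close>.\<close>
      have "(\<Sum>i\<in>I. if i \<in> insert k J then \<theta> i else - \<theta> i) =
          (\<Sum>i\<in>I. if i = k then \<theta> i else - \<theta> i)"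
        using disj by (intro sum.cong) auto
      moreover have "(\<Sum>j\<in>J. if j \<in> insert k J then \<theta> j else - \<theta> j) = 1"
        using \<theta>_sum by simp
      ultimately show ?thesis
        using k sum_signed_singleton[OF fin(1) k(1) \<theta>_sum(1)]
        by (intro not_diss[of "insert k J"]) auto
    next
      case 2
      then obtain k where k: "k \<in> J" "0 < \<theta> k" "\<theta> k < 1"
        using weight_strictly_between_0_1[of J \<theta>] fin \<theta> \<theta>_sum by blast
      \<comment> \<open>With \<open>L = J - {k}\<close> the incoming sum is -1, below the outgoing
        sum \<open>1 - 2 * \<theta> k\<close>; \<open>k\<close> witnesses
        \<open>J - L \<noteq> {}\<close>.\<close>
      have "(\<Sum>j\<in>J. if j \<in> J - {k} then \<theta> j else - \<theta> j) =
          - (\<Sum>j\<in>J. if j = k then \<theta> j else - \<theta> j)"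
        unfolding sum_negf[symmetric] by (intro sum.cong) auto
      moreover have "(\<Sum>i\<in>I. if i \<in> J - {k} then \<theta> i else - \<theta> i) = (\<Sum>i\<in>I. - \<theta> i)"
        using disj by (intro sum.cong) auto
      ultimately show ?thesis
        using k sum_signed_singleton[OF fin(2) k(1) \<theta>_sum(2)] \<theta>_sum(1)
        by (intro not_diss[of "J - {k}"]) (auto simp: sum_negf)
    qed
  qed
  ultimately show ?thesis by blast
qed

end
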